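(* For every positive integer $n$, let $$T_n=\{\omega\in\{1,2\}^*_n \mid \lambda=\lambda(\omega),\ \lambda_1\le n-N_\omega(1),\ N_\omega(1)-1\le l(\lambda)=\lambda_{l(\lambda)}\le N_\omega(1)\}.$$ Then $\Gamma(F'_n)=T_n$. Moreover, $(F'_n,T_n)$ is an Eulerian pair.
   Context: $\{1,2\}^*_n$ is the set of words of length $n$ on $\{1,2\}$. For a word $\omega=a_1\cdots a_n$, $\mathrm{des}(\omega)=\#\{i:1\le i\le n-1,\ a_i>a_{i+1}\}$, and $\mathrm{exc}(\omega)=\#\{i:a_i>x_i\}$ where $x_1\le\cdots\le x_n$ is the nondecreasing rearrangement of the letters of $\omega$. For finite sets $S,T$ of words, $(S,T)$ is an Eulerian pair if for every $j$, $\#\{\omega\in S:\mathrm{des}(\omega)=j\}=\#\{\omega\in T:\mathrm{exc}(\omega)=j\}$. A Fibonacci word is a word on $\{1,2\}$ with no two consecutive $1$'s; $F'_n$ is the set of Fibonacci words of length $n$ ending with $1$. $N_\omega(1)$ is the number of $1$'s in $\omega$. For a binary word $\omega$, $\lambda(\omega)$ is the partition whose parts are the positive values among $c_1,\dots,c_{N_\omega(1)}$, where $c_r$ is the number of $2$'s to the left of the $r$-th $1$ in $\omega$, listed as $\lambda_1\ge\cdots\ge\lambda_{l(\lambda)}>0$, with $l(\lambda)$ the number of parts. Steingrímsson's map $\phi$: for a permutation $\pi=\pi_1\cdots\pi_n$ of $[n]$ set $\pi_0=0$ and define $\phi(\pi)=f(1)\cdots f(n)$ by, for each $k=1,\dots,n$: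 (1) if some $m$ with $k<m\le n$ has $\pi_m<\pi_k$, set $f(\pi_{k+1})=\pi_k$; (2) if $\pi_k<\pi_m$ for all $k<m\le n$, set $f(\pi_{j+1})=\pi_k$ with $j$ the largest index in $\{0,\dots,k-1\}$ having $\pi_j<\pi_k$. The standardization of $\omega=a_1\cdots a_n$ is $\beta_\omega(1)\cdots\beta_\omega(n)$ with $\beta_\omega(i)=\#\{j:a_j<a_i\}+\#\{j\le i:a_j=a_i\}$. $\Gamma(\omega)=a_{j_1}\cdots a_{j_n}$, where $\phi(\beta_\omega(1)\cdots\beta_\omega(n))=f(1)\cdots f(n)$ and $j_i$ is the unique index with $\beta_\omega(j_i)=f(i)$; $\Gamma(F'_n)=\{\Gamma(\omega):\omega\in F'_n\}$.
   Formalization: For words whose partition λ is empty, λ_{l(λ)}=λ_0 is undefined; it is read as n−N_ω(1), so that 1 lies in T_1 and no other word with empty λ lies in any T_n (excluding such words breaks n=1, and λ_0=0 would put 2^n in T_n). *)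

theory Defs
  imports Main
begin

text \<open>Words are lists of natural numbers. The mathematical indices of words start at 1, those of
  lists at 0; hence the \<open>i\<close>-th letter of \<open>w\<close> is \<open>w ! (i - 1)\<close>.\<close>

definition words12 :: "nat \<Rightarrow> nat list set" where
  "words12 n = {w. length w = n \<and> set w \<subseteq> {1, 2}}"

definition des :: "nat list \<Rightarrow> nat" where
  "des w = card {i. Suc i < length w \<and> w ! i > w ! Suc i}"

definition exc :: "nat list \<Rightarrow> nat" where
  "exc w = card {i. i < length w \<and> w ! i > sort w ! i}"

definition eulerian_pair :: "nat list set \<Rightarrow> nat list set \<Rightarrow> bool" where
  "eulerian_pair S T \<longleftrightarrow> finite S \<and> finite T \<and>
     (\<forall>j. card {w \<in> S. des w = j} = card {w \<in> T. exc w = j})"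

definition fibonacci_word :: "nat list \<Rightarrow> bool" where
  "fibonacci_word w \<longleftrightarrow> set w \<subseteq> {1, 2} \<and>
     (\<forall>i. Suc i < length w \<longrightarrow> \<not> (w ! i = 1 \<and> w ! Suc i = 1))"

definition fib_words_end1 :: "nat \<Rightarrow> nat list set" where
  "fib_words_end1 n = {w. fibonacci_word w \<and> length w = n \<and> w \<noteq> [] \<and> last w = 1}"

definition twos_left :: "nat list \<Rightarrow> nat list" where
  "twos_left w =
     map (\<lambda>p. card {q. q < p \<and> w ! q = 2}) (filter (\<lambda>p. w ! p = 1) [0..<length w])"

definition lam :: "nat list \<Rightarrow> nat list" where
  "lam w = rev (sort (filter (\<lambda>c. c > 0) (twos_left w)))"

text \<open>The part of index \<open>i\<close> (from 1) of a partition whose parts are at most \<open>b\<close>. It is padded by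
  \<open>0\<close> beyond the last part; the index \<open>0\<close>, which is hit by the last part of the empty partition,
  gives the bound \<open>b\<close>, so that \<open>b = \<lambda>\<^sub>0 \<ge> \<lambda>\<^sub>1 \<ge> \<dots>\<close>.\<close>

definition part :: "nat \<Rightarrow> nat list \<Rightarrow> nat \<Rightarrow> nat" where
  "part b l i = (if i = 0 then b else if i \<le> length l then l ! (i - 1) else 0)"

text \<open>The parts of \<open>lam w\<close> are bounded by the number \<open>n - N\<close> of letters \<open>2\<close>. The convention for
  \<open>\<lambda>\<^sub>0\<close> matters only when \<open>lam w\<close> is empty: the word \<open>[1]\<close> satisfies the conditions (with
  \<open>0 = \<lambda>\<^sub>0 = n - N\<close>), and no other word with empty \<open>lam w\<close> does.\<close>

definition T_words :: "nat \<Rightarrow> nat list set" where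
  "T_words n = {w \<in> words12 n.
     let l = lam w; N = count_list w 1; b = n - N in
       part b l 1 \<le> n - N \<and>
       int N - 1 \<le> int (length l) \<and>
       length l = part b l (length l) \<and>
       part b l (length l) \<le> N}"

text \<open>\<open>entry p k\<close> is \<open>\<pi>\<^sub>k\<close>, including \<open>\<pi>\<^sub>0 = 0\<close>.\<close>

definition entry :: "nat list \<Rightarrow> nat \<Rightarrow> nat" where
  "entry p k = (if k = 0 then 0 else p ! (k - 1))"

text \<open>\<open>phi_arg p k\<close> is the argument at which step \<open>k\<close> of the map assigns \<open>f\<close> the value \<open>\<pi>\<^sub>k\<close>. Each
  \<open>v \<in> {1..n}\<close> is the argument of exactly one step if \<open>p\<close> is a permutation of \<open>{1..n}\<close>.\<close>

definition phi_arg :: "nat list \<Rightarrow> nat \<Rightarrow> nat" where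
  "phi_arg p k =
     (if \<exists>m. k < m \<and> m \<le> length p \<and> entry p m < entry p k
      then entry p (k + 1)
      else entry p (Max {j. j < k \<and> entry p j < entry p k} + 1))"

definition phi :: "nat list \<Rightarrow> nat list" where
  "phi p = map (\<lambda>v. THE u. \<exists>k\<in>{1..length p}. phi_arg p k = v \<and> u = entry p k) [1..<length p + 1]"

definition standardization :: "nat list \<Rightarrow> nat list" where
  "standardization w =
     map (\<lambda>i. card {j. j < length w \<and> w ! j < w ! i} + card {j. j \<le> i \<and> w ! j = w ! i})
       [0..<length w]"

definition Gam :: "nat list \<Rightarrow> nat list" where
  "Gam w = map (\<lambda>v. w ! (THE j. j < length w \<and> standardization w ! j = v))
             (phi (standardization w))"

end

theory Submission
  imports Defs
begin

text \<open>For a word \<open>w\<close> on \<open>{1,2}\<close> ending with \<open>1\<close>, Steingrimsson's map permutes cyclically the values of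
  the standardization on each block \<open>2\<dots>21\<close>, so that \<open>Gam w\<close> is obtained by writing under each letter of \<open>w\<close> its
  predecessor (with \<open>1\<close> before the first letter) and reading the predecessors of the \<open>1\<close>s, then
  those of the \<open>2\<close>s. A word in \<open>F'\<^sub>n\<close> is a possible initial \<open>1\<close> followed by blocks \<open>2\<^sup>a\<^sup>+\<^sup>1 1\<close>; its image is the
  possible \<open>1\<close>, as many \<open>2\<close>s as there are blocks, and then the words \<open>1 2\<^sup>a\<close>. These images are exactly
  the words in \<open>T\<^sub>n\<close>, they determine the exponents \<open>a\<close>, and both \<open>des\<close> of the word and \<open>exc\<close> of the
  image are the number of blocks.\<close>

section \<open>Standardization\<close>

lemma length_standardization [simp]: "length (standardization w) = length w"
  by (simp add: standardization_def)

lemma nth_standardization: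
  assumes "i < length w"
  shows "standardization w ! i =
    card {j. j < length w \<and> w ! j < w ! i} + card {j. j \<le> i \<and> w ! j = w ! i}"
  using assms by (simp add: standardization_def)

text \<open>If the letter at \<open>i\<close> is smaller, everything counted there is a letter
  smaller than \<open>w ! j\<close>, and \<open>j\<close> also counts itself. If the letters are
  equal, the first summands agree and the second set gains \<open>j\<close>.\<close>

lemma standardization_less:
  assumes ij: "i < length w" "j < length w" and less: "w ! i < w ! j \<or> w ! i = w ! j \<and> i < j"
  shows "standardization w ! i < standardization w ! j"
  using less
proof
  assume lt: "w ! i < w ! j"
  let ?A = "{k. k < length w \<and> w ! k < w ! i}" and ?B = "{k. k \<le> i \<and> w ! k = w ! i}"
  have "card ?A + card ?B = card (?A \<union> ?B)"
    by (rule card_Un_disjoint[symmetric]) auto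
  also have "\<dots> \<le> card {k. k < length w \<and> w ! k < w ! j}"
    using ij lt by (intro card_mono) auto
  finally have "card ?A + card ?B \<le> card {k. k < length w \<and> w ! k < w ! j}" .
  moreover have "0 < card {k. k \<le> j \<and> w ! k = w ! j}"
    by (subst card_gt_0_iff) auto
  ultimately show ?thesis
    using ij by (simp add: nth_standardization)
next
  assume eq: "w ! i = w ! j \<and> i < j"
  have "{k. k \<le> i \<and> w ! k = w ! i} \<subset> {k. k \<le> j \<and> w ! k = w ! j}"
  proof -
    have "j \<in> {k. k \<le> j \<and> w ! k = w ! j}" "j \<notin> {k. k \<le> i \<and> w ! k = w ! i}"
      using eq by auto
    moreover have "{k. k \<le> i \<and> w ! k = w ! i} \<subseteq> {k. k \<le> j \<and> w ! k = w ! j}"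
      using eq by auto
    ultimately show ?thesis by blast
  qed
  then have "card {k. k \<le> i \<and> w ! k = w ! i} < card {k. k \<le> j \<and> w ! k = w ! j}"
    by (intro psubset_card_mono) auto
  then show ?thesis
    using ij eq by (simp add: nth_standardization)
qed

lemma standardization_inject:
  assumes "i < length w" "j < length w"
  shows "standardization w ! i = standardization w ! j \<longleftrightarrow> i = j"
  using standardization_less[of i w j] standardization_less[of j w i] assms
  by (metis less_irrefl linorder_neqE_nat)

lemma set_standardization: "set (standardization w) = {1..length w}"
proof (rule card_subset_eq)
  show "set (standardization w) \<subseteq> {1..length w}"
  proof
    fix v assume "v \<in> set (standardization w)"
    then obtain i where i: "i < length w" "v = standardization w ! i"
      by (auto simp: in_set_conv_nth)
    let ?A = "{k. k < length w \<and> w ! k < w ! i}" and ?B = "{k. k \<le> i \<and> w ! k = w ! i}"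
    have "card ?A + card ?B = card (?A \<union> ?B)"
      by (rule card_Un_disjoint[symmetric]) auto
    also have "\<dots> \<le> card {..<length w}"
      using i by (intro card_mono) auto
    finally have "v \<le> length w"
      using i by (simp add: nth_standardization)
    moreover have "0 < card ?B"
      by (subst card_gt_0_iff) auto
    ultimately show "v \<in> {1..length w}"
      using i by (simp add: nth_standardization)
  qed
  have "distinct (standardization w)"
    by (simp add: distinct_conv_nth standardization_inject)
  then show "card (set (standardization w)) = card {1..length w}"
    by (simp add: distinct_card)
qed simp

text \<open>The positions of the 1s followed by those of the 2s form the inverse permutation of the
  standardization. This turns reading \<open>phi\<close> by arguments into reading by positions of
  \<open>w\<close>.\<close>

lemma standardization_sorted_positions:
  assumes "set w \<subseteq> {1, 2}"
  shows "map ((!) (standardization w))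
      (filter (\<lambda>i. w ! i = 1) [0..<length w] @ filter (\<lambda>i. w ! i = 2) [0..<length w])
    = [1..<length w + 1]" (is "map ?s ?P = _")
proof (rule sorted_distinct_set_unique)
  have upt: "sorted_wrt (<) [0..<length w]"
    by simp
  have block: "sorted_wrt (\<lambda>i j. ?s i < ?s j) (filter (\<lambda>i. w ! i = c) [0..<length w])" for c
  proof (rule sorted_wrt_mono_rel[OF _ sorted_wrt_filter[OF upt]])
    fix i j
    assume "i \<in> set (filter (\<lambda>i. w ! i = c) [0..<length w])"
      "j \<in> set (filter (\<lambda>i. w ! i = c) [0..<length w])" "i < j"
    then show "?s i < ?s j"
      by (intro standardization_less) auto
  qed
  have "sorted_wrt (\<lambda>i j. ?s i < ?s j) ?P"
    using block[of 1] block[of 2]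
    by (auto simp: sorted_wrt_append intro!: standardization_less)
  then have strict: "sorted_wrt (<) (map ?s ?P)"
    by (simp only: sorted_wrt_map)
  then show "sorted (map ?s ?P)" "distinct (map ?s ?P)"
    by (auto simp only: strict_sorted_iff)
  have "w ! i \<in> {1, 2}" if "i < length w" for i
    using assms nth_mem[OF that] by blast
  then have "set ?P = {..<length w}"
    by auto
  then have "set (map ?s ?P) = ?s ` {..<length w}"
    by (simp only: set_map)
  also have "\<dots> = set (standardization w)"
    by (auto simp: set_conv_nth)
  finally show "set (map ?s ?P) = set [1..<length w + 1]"
    unfolding set_standardization by auto
qed (simp_all del: upt_Suc)

section \<open>The map on binary words ending with 1\<close>

text \<open>The final 1 has a smaller value than any 2 and lies to its right, so the first case of
  \<open>phi_arg\<close> applies.\<close>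

lemma phi_arg_two:
  assumes "w \<noteq> []" "last w = 1" "p < length w" "w ! p = 2"
  shows "Suc p < length w" "phi_arg (standardization w) (Suc p) = standardization w ! Suc p"
proof -
  have last: "w ! (length w - 1) = 1"
    using assms by (simp add: last_conv_nth)
  have "p \<noteq> length w - 1"
    using last assms by auto
  then show less: "Suc p < length w"
    using assms by linarith
  have "standardization w ! (length w - 1) < standardization w ! p"
    using assms last by (intro standardization_less) auto
  then have "\<exists>m. Suc p < m \<and> m \<le> length w \<and> 
      entry (standardization w) m < entry (standardization w) (Suc p)"
    using less by (intro exI[of _ "length w"]) (auto simp: entry_def)
  then show "phi_arg (standardization w) (Suc p) = standardization w ! Suc p"
    by (simp add: phi_arg_def) (simp add: entry_def)
qed

text \<open>Here \<open>q\<close> starts the run of 2s ending just before the 1 at \<open>p\<close>.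
  No value to the right of \<open>p\<close> is smaller, so the second case of \<open>phi_arg\<close>
  applies; the 2s of the run have larger values, so the search to the left stops just before
  \<open>q\<close>.\<close>

lemma phi_arg_one:
  assumes w: "set w \<subseteq> {1, 2}" and p: "p < length w" "w ! p = 1" and "q \<le> p"
    and twos: "\<And>r. q \<le> r \<Longrightarrow> r < p \<Longrightarrow> w ! r = 2"
    and start: "q = 0 \<or> w ! (q - 1) = 1"
  shows "phi_arg (standardization w) (Suc p) = standardization w ! q"
proof -
  let ?s = "standardization w"
  have "?s ! p < ?s ! (m - 1)" if m: "Suc p < m" "m \<le> length w" for m
  proof (rule standardization_less)
    have "w ! (m - 1) \<in> {1, 2}"
      using w m nth_mem[of "m - 1" w] by force
    then show "w ! p < w ! (m - 1) \<or> w ! p = w ! (m - 1) \<and> p < m - 1"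
      using p m by auto
  qed (use m p in auto)
  then have no: "\<not> (\<exists>m. Suc p < m \<and> m \<le> length ?s \<and> entry ?s m < entry ?s (Suc p))"
    by (force simp: entry_def not_less)
  \<comment> \<open>\<open>entry\<close> counts from 1: index \<open>q\<close> is the list position
    \<open>q - 1\<close> before the run, or the artificial entry 0 if \<open>q = 0\<close>, and
    index \<open>q + 1\<close> is the position \<open>q\<close>.\<close>
  have "Max {j. j < Suc p \<and> entry ?s j < entry ?s (Suc p)} = q"
  proof (rule Max_eqI)
    show "q \<in> {j. j < Suc p \<and> entry ?s j < entry ?s (Suc p)}"
    proof (cases "q = 0")
      case True
      have "?s ! p \<in> {1..length w}"
        using p nth_mem[of p ?s] unfolding set_standardization by simp
      then show ?thesis
        using True by (simp add: entry_def)
    next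
      case False
      then have "?s ! (q - 1) < ?s ! p"
        using p start \<open>q \<le> p\<close> by (intro standardization_less) auto
      then show ?thesis
        using False \<open>q \<le> p\<close> by (simp add: entry_def)
    qed
  next
    fix j assume j: "j \<in> {j. j < Suc p \<and> entry ?s j < entry ?s (Suc p)}"
    show "j \<le> q"
    proof (rule ccontr)
      assume "\<not> j \<le> q"
      then have "w ! (j - 1) = 2"
        using j by (intro twos) auto
      then have "?s ! p < ?s ! (j - 1)"
        using j p by (intro standardization_less) auto
      with j \<open>\<not> j \<le> q\<close> show False
        by (simp add: entry_def)
    qed
  qed simp
  then have "phi_arg ?s (Suc p) = entry ?s (q + 1)"
    by (simp only: phi_arg_def no if_False)
  then show ?thesis
    by (simp add: entry_def)
qed

text \<open>Either \<open>q\<close> starts a block and the 1 closing that block is sent to it, or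
  the 2 just before \<open>q\<close> is. In both cases the letter at \<open>p\<close> equals the
  letter before \<open>q\<close>, with a 1 imagined before the word.\<close>

lemma phi_arg_preimage:
  assumes w: "set w \<subseteq> {1, 2}" "w \<noteq> []" "last w = 1" and q: "q < length w"
  shows "\<exists>p<length w. phi_arg (standardization w) (Suc p) = standardization w ! q \<and>
    w ! p = (1 # w) ! q"
proof (cases "(1 # w) ! q = 1")
  case True
  \<comment> \<open>The 1 closing the block that starts at \<open>q\<close>; it exists because
    \<open>w\<close> ends with 1.\<close>
  define p where "p = (LEAST p. q \<le> p \<and> w ! p = 1)"
  have last: "q \<le> length w - 1 \<and> w ! (length w - 1) = 1"
    using w q by (auto simp: last_conv_nth)
  have p: "q \<le> p \<and> w ! p = 1"
    unfolding p_def by (rule LeastI[of "\<lambda>p. q \<le> p \<and> w ! p = 1", OF last])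
  have "p \<le> length w - 1"
    unfolding p_def by (rule Least_le[of "\<lambda>p. q \<le> p \<and> w ! p = 1", OF last])
  then have len: "p < length w"
    using q by linarith
  have "phi_arg (standardization w) (Suc p) = standardization w ! q"
  proof (rule phi_arg_one)
    fix r assume r: "q \<le> r" "r < p"
    then have "w ! r \<noteq> 1"
      unfolding p_def by (auto dest: not_less_Least)
    moreover have "w ! r \<in> {1, 2}"
      using w r len nth_mem[of r w] by force
    ultimately show "w ! r = 2" by auto
  next
    show "q = 0 \<or> w ! (q - 1) = 1"
      using True by (auto simp: nth_Cons split: nat.splits)
  qed (use w p len in auto)
  then show ?thesis
    using p len True by auto
next
  case False
  then obtain p where p: "q = Suc p"
    by (cases q) auto
  have "w ! p \<in> {1, 2}"
    using w q p nth_mem[of p w] by force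
  with False p have "w ! p = 2" by auto
  then show ?thesis
    using phi_arg_two[of w p] w q p by (intro exI[of _ p]) simp
qed

lemma Gam_conv_biword:
  assumes w: "set w \<subseteq> {1, 2}" "w \<noteq> []" "last w = 1"
  shows "Gam w = map fst (filter (\<lambda>x. snd x = 1) (zip (1 # w) w)) @
    map fst (filter (\<lambda>x. snd x = 2) (zip (1 # w) w))"
proof -
  let ?s = "standardization w" and ?n = "length w"
  let ?P = "\<lambda>c. filter (\<lambda>i. w ! i = c) [0..<?n]"
  define f where "f v = (THE u. \<exists>k\<in>{1..?n}. phi_arg ?s k = v \<and> u = entry ?s k)" for v
  define g where "g v = w ! (THE j. j < ?n \<and> ?s ! j = v)" for v
  have onto: "{1..?n} \<subseteq> phi_arg ?s ` {1..?n}"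
  proof
    fix v assume "v \<in> {1..?n}"
    then have "v \<in> set ?s"
      by (simp add: set_standardization)
    then obtain q where q: "q < ?n" "v = ?s ! q"
      by (auto simp: in_set_conv_nth)
    then obtain p where "p < ?n" "phi_arg ?s (Suc p) = v"
      using phi_arg_preimage[OF w q(1)] by auto
    then show "v \<in> phi_arg ?s ` {1..?n}"
      by (intro image_eqI[of _ _ "Suc p"]) auto
  qed
  \<comment> \<open>The arguments of the n steps cover n values, so they are distinct. Hence the
    \<open>THE\<close> in \<open>phi\<close> refers to a single step.\<close>
  have "card (phi_arg ?s ` {1..?n}) = card {1..?n}"
    using card_mono[OF _ onto] card_image_le[of "{1..?n}" "phi_arg ?s"] by simp
  then have inj: "inj_on (phi_arg ?s) {1..?n}"
    by (intro eq_card_imp_inj_on) auto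
  have letter: "g (f (?s ! q)) = (1 # w) ! q" if q: "q < ?n" for q
  proof -
    obtain p where p: "p < ?n" "phi_arg ?s (Suc p) = ?s ! q" "w ! p = (1 # w) ! q"
      using phi_arg_preimage[OF w q] by blast
    have "f (?s ! q) = entry ?s (Suc p)"
      unfolding f_def
    proof (rule the_equality)
      show "\<exists>k\<in>{1..?n}. phi_arg ?s k = ?s ! q \<and> entry ?s (Suc p) = entry ?s k"
        using p by (intro bexI[of _ "Suc p"]) auto
    next
      fix u assume "\<exists>k\<in>{1..?n}. phi_arg ?s k = ?s ! q \<and> u = entry ?s k"
      then obtain k where k: "k \<in> {1..?n}" "phi_arg ?s k = ?s ! q" "u = entry ?s k"
        by blast
      have "k = Suc p"
        using inj_onD[OF inj, of k "Suc p"] k p by auto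
      then show "u = entry ?s (Suc p)"
        using k by simp
    qed
    then have "f (?s ! q) = ?s ! p"
      by (simp add: entry_def)
    moreover have "(THE j. j < ?n \<and> ?s ! j = ?s ! p) = p"
      using p by (intro the_equality) (auto simp: standardization_inject)
    ultimately show ?thesis
      using p by (simp add: g_def)
  qed
  have "Gam w = map g (map f [1..<?n + 1])"
    by (simp add: Gam_def phi_def f_def g_def del: upt_Suc)
  also have "\<dots> = map g (map f (map ((!) ?s) (?P 1 @ ?P 2)))"
    by (simp only: standardization_sorted_positions[OF w(1)])
  also have "\<dots> = map ((!) (1 # w)) (?P 1 @ ?P 2)"
    by (auto simp: letter simp del: nth_Cons_0)
  finally have Gam: "Gam w = map ((!) (1 # w)) (?P 1 @ ?P 2)" .
  have "zip (1 # w) w = map (\<lambda>i. ((1 # w) ! i, w ! i)) [0..<?n]"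
    by (rule nth_equalityI) auto
  then have "map fst (filter (\<lambda>x. snd x = c) (zip (1 # w) w)) = map ((!) (1 # w)) (?P c)" for c
    by (simp add: filter_map o_def)
  then show ?thesis
    by (simp only: Gam map_append)
qed

section \<open>Block decompositions\<close>

text \<open>With the exponent \<open>Suc a\<close>, every list of naturals encodes a word in which
  each 1 follows a 2.\<close>

definition two_one_blocks :: "nat list \<Rightarrow> nat list" where
  "two_one_blocks xs = concat (map (\<lambda>a. replicate (Suc a) 2 @ [1]) xs)"

definition one_two_blocks :: "nat list \<Rightarrow> nat list" where
  "one_two_blocks xs = concat (map (\<lambda>a. 1 # replicate a 2) xs)"

definition fib_word_of :: "bool \<Rightarrow> nat list \<Rightarrow> nat list" where
  "fib_word_of b xs = (if b then [1] else []) @ two_one_blocks xs"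

definition T_word_of :: "bool \<Rightarrow> nat list \<Rightarrow> nat list" where
  "T_word_of b xs = (if b then [1] else []) @ replicate (length xs) 2 @ one_two_blocks xs"

lemma two_one_blocks_simps [simp]:
  "two_one_blocks [] = []"
  "two_one_blocks (a # xs) = 2 # replicate a 2 @ 1 # two_one_blocks xs"
  by (simp_all add: two_one_blocks_def)

lemma one_two_blocks_simps [simp]:
  "one_two_blocks [] = []"
  "one_two_blocks (a # xs) = 1 # replicate a 2 @ one_two_blocks xs"
  by (simp_all add: one_two_blocks_def)

lemma set_two_one_blocks: "set (two_one_blocks xs) \<subseteq> {1, 2}"
  by (induction xs) auto

lemma set_one_two_blocks: "set (one_two_blocks xs) \<subseteq> {1, 2}"
  by (induction xs) auto

lemma last_two_one_blocks: "xs \<noteq> [] \<Longrightarrow> last (two_one_blocks xs) = 1"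
  by (induction xs rule: rev_induct) (auto simp: two_one_blocks_def)

lemma length_two_one_blocks:
  "length (two_one_blocks xs) = length xs + length (one_two_blocks xs)"
  by (induction xs) auto

lemma length_fib_word_of: "length (fib_word_of b xs) = length (T_word_of b xs)"
  by (simp add: fib_word_of_def T_word_of_def length_two_one_blocks)

lemma set_fib_word_of: "set (fib_word_of b xs) \<subseteq> {1, 2}"
  using set_two_one_blocks[of xs] by (auto simp: fib_word_of_def)

lemma set_T_word_of: "set (T_word_of b xs) \<subseteq> {1, 2}"
  using set_one_two_blocks[of xs] by (auto simp: T_word_of_def)

lemma last_fib_word_of: "fib_word_of b xs \<noteq> [] \<Longrightarrow> last (fib_word_of b xs) = 1"
  using last_two_one_blocks[of xs] by (cases "xs = []") (auto simp: fib_word_of_def)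

lemma count_list_one_two_blocks [simp]: "count_list (one_two_blocks xs) 1 = length xs"
  by (induction xs) (auto simp: count_list_0_iff)

text \<open>Cutting before each 1 leaves a leading run of 2s. Membership in \<open>T_words\<close>
  is decided on this normal form.\<close>

lemma binary_word_one_two_blocks:
  assumes "set w \<subseteq> {1, 2}"
  obtains a xs where "w = replicate a 2 @ one_two_blocks xs"
proof -
  have "\<exists>a xs. w = replicate a 2 @ one_two_blocks xs"
    using assms
  proof (induction w)
    case Nil
    show ?case by (intro exI[of _ 0] exI[of _ "[]"]) simp
  next
    case (Cons c w)
    then obtain a xs where w: "w = replicate a 2 @ one_two_blocks xs" by auto
    consider "c = 1" | "c = 2" using Cons.prems by auto
    then show ?case
    proof cases
      case 1
      then show ?thesis using w by (intro exI[of _ 0] exI[of _ "a # xs"]) simp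
    next
      case 2
      then show ?thesis using w by (intro exI[of _ "Suc a"] exI[of _ xs]) simp
    qed
  qed
  then show ?thesis using that by blast
qed

lemma replicate_one_two_blocks_inject:
  "replicate a 2 @ one_two_blocks xs = replicate b 2 @ one_two_blocks ys \<longleftrightarrow> a = b \<and> xs = ys"
proof
  \<comment> \<open>The leading 2s are followed by a 1 or by nothing, so their number can be read
    off the word.\<close>
  have exponent: "takeWhile ((=) 2) (replicate c 2 @ one_two_blocks zs) = replicate c 2" for c zs
    by (cases zs; induction c) simp_all
  show "replicate a 2 @ one_two_blocks xs = replicate b 2 @ one_two_blocks ys \<Longrightarrow> a = b \<and> xs = ys"
  proof (induction xs arbitrary: a b ys)
    case Nil
    have "a = b"
      using arg_cong[OF Nil, of "\<lambda>v. length (takeWhile ((=) 2) v)"] by (simp only: exponent) simp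
    with Nil have "one_two_blocks ys = []" by simp
    with \<open>a = b\<close> show ?case by (cases ys) simp_all
  next
    case (Cons x xs)
    have "a = b"
      using arg_cong[OF Cons.prems, of "\<lambda>v. length (takeWhile ((=) 2) v)"]
      by (simp only: exponent) simp
    with Cons.prems have eq: "one_two_blocks (x # xs) = one_two_blocks ys" by simp
    then obtain y zs where ys: "ys = y # zs"
      by (cases ys) auto
    with eq have "replicate x 2 @ one_two_blocks xs = replicate y 2 @ one_two_blocks zs"
      by simp
    from Cons.IH[OF this] \<open>a = b\<close> ys show ?case by simp
  qed
qed auto

text \<open>The first letter is 1 exactly if \<open>b\<close> holds. Without that initial 1, the
  word is in normal form with leading exponent \<open>length xs\<close>.\<close>

lemma T_word_of_inject:
  assumes eq: "T_word_of b xs = T_word_of c ys" and "T_word_of b xs \<noteq> []"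
  shows "b = c \<and> xs = ys"
proof -
  have "b = c"
    using assms by (cases b; cases c; cases xs; cases ys) (simp_all add: T_word_of_def)
  with eq have "replicate (length xs) 2 @ one_two_blocks xs
      = replicate (length ys) 2 @ one_two_blocks ys"
    by (simp add: T_word_of_def)
  with \<open>b = c\<close> show ?thesis
    by (simp only: replicate_one_two_blocks_inject)
qed

text \<open>In each block, the predecessor of the 1 is a 2, and the predecessors of the
  \<open>Suc a\<close> 2s are a 1 followed by \<open>a\<close> 2s. An initial 1 has the imagined 1
  as its predecessor.\<close>

lemma Gam_fib_word_of:
  assumes "fib_word_of b xs \<noteq> []"
  shows "Gam (fib_word_of b xs) = T_word_of b xs"
proof -
  \<comment> \<open>The state after the first letter of a block: that 2 is now the pending
    predecessor. At the end of the block the pending predecessor is 1 again, which drives the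
    inductions on \<open>xs\<close>.\<close>
  have twos: "zip (2 # replicate a 2 @ 1 # w) (replicate a 2 @ 1 # w)
      = replicate a (2, 2) @ (2, 1) # zip (1 # w) w" for a :: nat and w :: "nat list"
    by (induction a) auto
  have "map fst (filter (\<lambda>x. snd x = 1) (zip (1 # two_one_blocks xs) (two_one_blocks xs)))
      = replicate (length xs) 2"
    by (induction xs) (simp_all add: twos del: One_nat_def)
  moreover have "map fst (filter (\<lambda>x. snd x = 2) (zip (1 # two_one_blocks xs) (two_one_blocks xs)))
      = one_two_blocks xs"
    by (induction xs) (simp_all add: twos del: One_nat_def)
  ultimately show ?thesis
    by (subst Gam_conv_biword[OF set_fib_word_of assms last_fib_word_of[OF assms]])
      (simp add: fib_word_of_def T_word_of_def)
qed

section \<open>Fibonacci words\<close>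

lemma fibonacci_word_conv_successively:
  "fibonacci_word w \<longleftrightarrow> set w \<subseteq> {1, 2} \<and> successively (\<lambda>x y. \<not> (x = 1 \<and> y = 1)) w"
  by (auto simp: fibonacci_word_def successively_conv_nth)

lemma fibonacci_word_fib_word_of: "fibonacci_word (fib_word_of b xs)"
proof -
  let ?P = "\<lambda>x y. x = (1::nat) \<longrightarrow> y \<noteq> (1::nat)"
  have twos: "successively ?P (2 # replicate a 2 @ 1 # w) = successively ?P (1 # w)" for a w
    by (induction a) auto
  \<comment> \<open>The prepended 1 stands for the end of the preceding block and also serves as the
    initial 1 if \<open>b\<close> holds.\<close>
  have "successively ?P (1 # two_one_blocks xs)"
    by (induction xs) (auto simp: twos simp del: One_nat_def)
  then have "successively ?P (fib_word_of b xs)"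
    by (auto simp: fib_word_of_def successively_Cons)
  then show ?thesis
    using set_fib_word_of by (simp add: fibonacci_word_conv_successively)
qed

text \<open>The word is built from its right end. A new 1 can only precede a 2 and sets
  \<open>b\<close>; a new 2 turns an initial 1 into a block with exponent 0, or else lengthens the
  first block.\<close>

lemma fib_words_end1_obtain:
  assumes "fibonacci_word w" "w \<noteq> []" "last w = 1"
  shows "\<exists>b xs. w = fib_word_of b xs"
  using assms unfolding fibonacci_word_conv_successively
proof (induction w)
  case (Cons c w)
  show ?case
  proof (cases "w = []")
    case True
    then show ?thesis
      using Cons.prems by (intro exI[of _ True] exI[of _ "[]"]) (simp add: fib_word_of_def)
  next
    case False
    then obtain b xs where w: "w = fib_word_of b xs"
      using Cons by (auto simp: successively_Cons)
    consider "c = 1" | "c = 2" using Cons.prems by auto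
    then show ?thesis
    proof cases
      case 1
      then have "hd w \<noteq> 1"
        using Cons.prems False by (auto simp: successively_Cons)
      then have "\<not> b" using w by (auto simp: fib_word_of_def)
      then show ?thesis
        using 1 w by (intro exI[of _ True] exI[of _ xs]) (simp add: fib_word_of_def)
    next
      case 2
      show ?thesis
      proof (cases b)
        case True
        then show ?thesis
          using 2 w by (intro exI[of _ False] exI[of _ "0 # xs"]) (simp add: fib_word_of_def)
      next
        case b: False
        with w False obtain a ys where "xs = a # ys"
          by (cases xs) (auto simp: fib_word_of_def)
        then show ?thesis
          using 2 b w by (intro exI[of _ False] exI[of _ "Suc a # ys"]) (simp add: fib_word_of_def)
      qed
    qed
  qed
qed simp

lemma fib_words_end1_eq:
  assumes "n > 0"
  shows "fib_words_end1 n = {fib_word_of b xs |b xs. length (T_word_of b xs) = n}"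
proof (intro Set.equalityI subsetI)
  fix w assume "w \<in> fib_words_end1 n"
  then show "w \<in> {fib_word_of b xs |b xs. length (T_word_of b xs) = n}"
    using fib_words_end1_obtain[of w] length_fib_word_of by (fastforce simp: fib_words_end1_def)
next
  fix w assume "w \<in> {fib_word_of b xs |b xs. length (T_word_of b xs) = n}"
  then obtain b xs where w: "w = fib_word_of b xs" "length w = n"
    by (auto simp: length_fib_word_of)
  then show "w \<in> fib_words_end1 n"
    using fibonacci_word_fib_word_of last_fib_word_of assms by (auto simp: fib_words_end1_def)
qed

section \<open>Partition of a binary word\<close>

lemma twos_left_Nil [simp]: "twos_left [] = []"
  by (simp add: twos_left_def)

text \<open>A 1 in front has no 2 to its left; a 2 in front lies to the left of every 1.\<close>

lemma twos_left_Cons: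
  "twos_left (c # w) =
    (if c = 1 then [0] else []) @ map (\<lambda>x. x + (if c = 2 then 1 else 0)) (twos_left w)"
proof -
  have card: "card {q. q < Suc p \<and> (c # w) ! q = 2}
      = card {q. q < p \<and> w ! q = 2} + (if c = 2 then 1 else 0)" for p c
  proof -
    have "{q. q < Suc p \<and> (c # w) ! q = 2}
        = (if c = 2 then {0} else {}) \<union> Suc ` {q. q < p \<and> w ! q = 2}" (is "?A = ?B")
    proof (rule set_eqI)
      show "q \<in> ?A \<longleftrightarrow> q \<in> ?B" for q
        by (cases q) auto
    qed
    then show ?thesis
      by (simp add: card_image)
  qed
  have "[0..<length (c # w)] = 0 # map Suc [0..<length w]"
    by (simp add: upt_conv_Cons map_Suc_upt del: upt_Suc)
  then show ?thesis
    by (simp add: twos_left_def filter_map o_def card del: upt_Suc)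
qed

lemma length_twos_left: "length (twos_left w) = count_list w 1"
  by (induction w) (auto simp: twos_left_Cons)

lemma sorted_twos_left: "sorted (twos_left w)"
  by (induction w) (auto simp: twos_left_Cons sorted_wrt_map)

lemma lam_conv_filter: "lam w = rev (filter (\<lambda>c. c > 0) (twos_left w))"
  by (simp add: lam_def sorted_sort_id sorted_wrt_filter sorted_twos_left)

lemma twos_left_replicate_append:
  "twos_left (replicate a 2 @ w) = map (\<lambda>x. x + a) (twos_left w)"
  by (induction a) (auto simp: twos_left_Cons)

lemma length_lam_le: "length (lam w) \<le> count_list w 1"
  using length_filter_le[of "\<lambda>c. c > 0" "twos_left w"]
  by (simp only: lam_conv_filter length_twos_left length_rev)

lemma lam_replicate_append:
  assumes "a > 0"
  shows "lam (replicate a 2 @ w) = rev (map (\<lambda>x. x + a) (twos_left w))"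
  using assms by (simp add: lam_conv_filter twos_left_replicate_append filter_map o_def)

lemma lam_one_Cons: "lam (1 # w) = lam w"
  by (simp add: lam_conv_filter twos_left_Cons)

lemma twos_left_le: "x \<in> set (twos_left w) \<Longrightarrow> x \<le> count_list w 2"
  by (induction w arbitrary: x) (auto simp: twos_left_Cons split: if_splits)

lemma count_list_binary:
  fixes w :: "nat list"
  shows "set w \<subseteq> {1, 2} \<Longrightarrow> count_list w 1 + count_list w 2 = length w"
  by (induction w) auto

text \<open>The conditions \<open>\<lambda>\<^sub>1 \<le> n - N\<close> and \<open>\<lambda>\<^sub>l \<le> N\<close> are redundant: \<open>\<lambda>\<close> has at most \<open>N\<close> parts, each at most
  the number of \<open>2\<close>s.\<close>

lemma T_words_iff:
  "w \<in> T_words n \<longleftrightarrow> w \<in> words12 n \<and> count_list w 1 - 1 \<le> length (lam w) \<and>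
    length (lam w) = part (n - count_list w 1) (lam w) (length (lam w))"
proof -
  have "part (n - count_list w 1) (lam w) 1 \<le> n - count_list w 1" if "w \<in> words12 n"
  proof -
    have "x \<le> n - count_list w 1" if "x \<in> set (lam w)" for x
      using that twos_left_le[of x w] count_list_binary[of w] \<open>w \<in> words12 n\<close>
      by (auto simp: lam_conv_filter words12_def)
    then show ?thesis
      by (cases "lam w") (auto simp: part_def)
  qed
  with length_lam_le[of w] show ?thesis
    unfolding T_words_def Let_def by auto
qed

lemma part_last: "l \<noteq> [] \<Longrightarrow> part b l (length l) = last l"
  by (simp add: part_def last_conv_nth)

text \<open>There are N = \<open>length xs\<close> 1s. If \<open>a > 0\<close>, all N counts are
  positive and the smallest is \<open>a\<close>, which must equal N. If \<open>a = 0\<close>, the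
  first count vanishes, so the remaining N - 1 must be positive, and for N > 1 the smallest of them
  is \<open>hd xs\<close>.\<close>

lemma replicate_one_two_blocks_in_T_words:
  fixes a :: nat and xs :: "nat list"
  defines "w \<equiv> replicate a 2 @ one_two_blocks xs"
  assumes "length w = n" "n > 0"
  shows "w \<in> T_words n \<longleftrightarrow>
    (if a = 0 then hd xs = length (tl xs) else a = length xs)"
proof -
  have w: "w \<in> words12 n"
    using assms set_one_two_blocks[of xs] by (auto simp: words12_def)
  have count: "count_list w 1 = length xs"
    by (simp add: w_def count_list_0_iff del: One_nat_def)
  have lam: "lam (replicate c 2 @ one_two_blocks ys) =
      rev (map (\<lambda>x. x + c) (twos_left (one_two_blocks ys)))" if "c > 0" for c ys
    using that by (rule lam_replicate_append)
  have length_lam: "length (lam (replicate c 2 @ one_two_blocks ys)) = length ys"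
    if "c > 0" for c ys
    using that by (simp add: lam length_twos_left del: One_nat_def)
  have last_lam: "last (lam (replicate c 2 @ one_two_blocks ys)) = c"
    if "c > 0" "ys \<noteq> []" for c ys
    unfolding lam[OF that(1)] using that(2) by (cases ys) (simp_all add: twos_left_Cons)
  show ?thesis
  proof (cases "a = 0")
    case False
    show ?thesis
    proof (cases "xs = []")
      case True
      \<comment> \<open>Without parts, \<open>part\<close> returns the bound, here n > 0, which
        differs from the length 0.\<close>
      then have "lam w = []"
        using length_lam[of a xs] False by (simp add: w_def)
      then show ?thesis
        using True False w count assms by (auto simp: T_words_iff part_def)
    next
      case xs: False
      then have "lam w \<noteq> []"
        using length_lam[of a xs] False by (auto simp: w_def simp flip: length_greater_0_conv)
      then have part: "part (n - count_list w 1) (lam w) (length (lam w)) = a"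
        using last_lam[of a xs] xs False by (simp add: part_last w_def)
      show ?thesis
        unfolding T_words_iff part using w count length_lam[of a xs] False by (auto simp: w_def)
    qed
  next
    case True
    with assms obtain x ys where xs: "xs = x # ys"
      by (cases xs) auto
    then have lam_w: "lam w = lam (replicate x 2 @ one_two_blocks ys)"
      using True by (simp add: w_def lam_one_Cons del: One_nat_def)
    show ?thesis
    proof (cases "ys = []")
      case True
      \<comment> \<open>With a single 1, \<open>part\<close> returns the bound n - 1 =
        \<open>x\<close>, so the condition becomes \<open>x = 0\<close>.\<close>
      then have "lam w = []"
        using lam_w by (simp add: lam_conv_filter twos_left_replicate_append[of _ "[]", simplified])
      then show ?thesis
        using True xs w count \<open>a = 0\<close> assms(2) by (auto simp: T_words_iff part_def w_def)
    next
      case False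
      then obtain y zs where ys: "ys = y # zs"
        by (cases ys) auto
      show ?thesis
      proof (cases "x = 0")
        case x: True
        \<comment> \<open>Two leading 1s have count 0, leaving at most N - 2 parts, so both sides of
          the equivalence fail.\<close>
        have "lam w = lam (replicate y 2 @ one_two_blocks zs)"
          by (simp add: lam_w x ys lam_one_Cons del: One_nat_def)
        then have "length (lam w) \<le> length zs"
          using length_lam_le[of "replicate y 2 @ one_two_blocks zs"]
          by (simp add: count_list_0_iff del: One_nat_def)
        then show ?thesis
          using x xs ys \<open>a = 0\<close> count by (auto simp: T_words_iff)
      next
        case x: False
        then have "lam w \<noteq> []"
          using length_lam[of x ys] False lam_w by (auto simp flip: length_greater_0_conv)
        then have part: "part (n - count_list w 1) (lam w) (length (lam w)) = x"
          using last_lam[of x ys] x False by (simp add: part_last lam_w)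
        show ?thesis
          unfolding T_words_iff part using w count length_lam[of x ys] lam_w x xs \<open>a = 0\<close> by auto
      qed
    qed
  qed
qed

lemma T_words_eq:
  assumes "n > 0"
  shows "T_words n = {T_word_of b xs |b xs. length (T_word_of b xs) = n}"
proof (intro Set.equalityI subsetI)
  fix w assume T: "w \<in> T_words n"
  then have w: "set w \<subseteq> {1, 2}" "length w = n"
    by (auto simp: T_words_def words12_def)
  obtain a xs where axs: "w = replicate a 2 @ one_two_blocks xs"
    using binary_word_one_two_blocks[OF w(1)] .
  have cond: "if a = 0 then hd xs = length (tl xs) else a = length xs"
    using T replicate_one_two_blocks_in_T_words[of a xs n] w assms by (simp add: axs)
  have "\<exists>b ys. w = T_word_of b ys"
  proof (cases "a = 0")
    case True
    with w assms axs obtain x ys where "xs = x # ys"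
      by (cases xs) auto
    \<comment> \<open>By \<open>cond\<close>, the first block is a 1 followed by
      \<open>length ys\<close> 2s: the initial letter and the run of 2s in
      \<open>T_word_of True ys\<close>.\<close>
    then show ?thesis
      using True cond axs by (intro exI[of _ True] exI[of _ ys]) (simp add: T_word_of_def)
  next
    case False
    then show ?thesis
      using cond axs by (intro exI[of _ False] exI[of _ xs]) (simp add: T_word_of_def)
  qed
  then show "w \<in> {T_word_of b xs |b xs. length (T_word_of b xs) = n}"
    using w by auto
next
  fix w assume "w \<in> {T_word_of b xs |b xs. length (T_word_of b xs) = n}"
  then obtain b xs where w: "w = T_word_of b xs" "length w = n" by auto
  show "w \<in> T_words n"
  proof (cases b)
    case True
    then show ?thesis
      using w assms replicate_one_two_blocks_in_T_words[of 0 "length xs # xs" n]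
      by (simp add: T_word_of_def)
  next
    case False
    then have "xs \<noteq> []" using w assms by (auto simp: T_word_of_def)
    with False show ?thesis
      using w assms replicate_one_two_blocks_in_T_words[of "length xs" xs n]
      by (simp add: T_word_of_def)
  qed
qed

section \<open>Descents and excedances\<close>

lemma des_Nil [simp]: "des [] = 0"
  by (simp add: des_def)

lemma des_Cons: "des (c # w) = (if w \<noteq> [] \<and> c > hd w then 1 else 0) + des w"
proof -
  have "{i. Suc i < length (c # w) \<and> (c # w) ! i > (c # w) ! Suc i}
      = (if w \<noteq> [] \<and> c > hd w then {0} else {}) \<union> Suc ` {i. Suc i < length w \<and> w ! i > w ! Suc i}"
    (is "?A = ?B")
  proof (rule set_eqI)
    show "i \<in> ?A \<longleftrightarrow> i \<in> ?B" for i
      by (cases i) (auto simp: hd_conv_nth)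
  qed
  moreover have "finite {i. Suc i < length w \<and> w ! i > w ! Suc i}"
    by (rule finite_subset[of _ "{..<length w}"]) auto
  ultimately show ?thesis
    by (auto simp: des_def card_image)
qed

text \<open>Each block has one descent, at its closing 1; a 1 is never the top of a descent.\<close>

lemma des_fib_word_of: "des (fib_word_of b xs) = length xs"
proof -
  have one: "des (1 # w) = des w" if "set w \<subseteq> {1, 2}" for w
    using that by (cases w) (auto simp: des_Cons)
  have twos: "des (2 # replicate a 2 @ 1 # w) = Suc (des (1 # w))" for a w
    by (induction a) (simp_all add: des_Cons)
  have "des (two_one_blocks xs) = length xs"
    by (induction xs) (simp_all add: twos one set_two_one_blocks del: One_nat_def)
  then show ?thesis
    using one[OF set_two_one_blocks] by (simp add: fib_word_of_def)
qed

lemma sort_binary_word: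
  fixes w :: "nat list"
  assumes "set w \<subseteq> {1, 2}"
  shows "sort w = replicate (count_list w 1) 1 @ replicate (count_list w 2) 2"
proof -
  have two: "insort 2 (replicate a (1::nat) @ replicate b 2) = replicate a 1 @ replicate (Suc b) 2"
    for a b
    by (induction a) (simp_all add: insort_is_Cons)
  have one: "insort 1 (replicate a (1::nat) @ replicate b 2) = replicate (Suc a) 1 @ replicate b 2"
    for a b
    by (subst insort_is_Cons) auto
  show ?thesis
    using assms by (induction w) (auto simp: one two simp del: One_nat_def, simp_all)
qed

text \<open>The sorted word starts with as many 1s as the optional initial 1 and the run of 2s have
  letters together. So the excedances are exactly the positions of that run; afterwards the sorted
  word has only 2s.\<close>

lemma exc_T_word_of: "exc (T_word_of b xs) = length xs"
proof -
  let ?w = "T_word_of b xs" and ?i = "if b then 1 else 0 :: nat"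
  have one: "count_list ?w 1 = ?i + length xs"
    by (simp add: T_word_of_def count_list_0_iff del: One_nat_def)
  then have len: "length ?w = ?i + length xs + count_list ?w 2"
    using count_list_binary[OF set_T_word_of[of b xs]] by simp
  have sort: "sort ?w ! i = (if i < ?i + length xs then 1 else 2)" if "i < length ?w" for i
    using that len by (simp add: sort_binary_word[OF set_T_word_of] one nth_append del: One_nat_def)
  have letter: "?w ! i \<in> {1, 2}" if "i < length ?w" for i
    using set_T_word_of nth_mem[OF that] by blast
  have first: "?w ! i = (if i < ?i then 1 else 2)" if "i < ?i + length xs" for i
    using that by (auto simp: T_word_of_def nth_append nth_Cons split: nat.splits)
  have "{i. i < length ?w \<and> ?w ! i > sort ?w ! i} = {?i..<?i + length xs}" (is "?A = ?B")
  proof (rule set_eqI)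
    fix i
    show "i \<in> ?A \<longleftrightarrow> i \<in> ?B"
    proof (cases "i < ?i + length xs")
      case True
      then have "i < length ?w" using len by linarith
      then show ?thesis
        using sort[of i] first[OF True] True by auto
    next
      case False
      then show ?thesis
        using sort[of i] letter[of i] by auto
    qed
  qed
  then show ?thesis
    by (simp add: exc_def)
qed

section \<open>Transfer of descents to excedances along \<open>Gam\<close>\<close>

theorem theorem3p4:
  fixes n :: nat
  assumes "n > 0"
  shows "Gam ` fib_words_end1 n = T_words n \<and> eulerian_pair (fib_words_end1 n) (T_words n)"
proof -
  let ?F = "fib_words_end1 n"
  have Gam: "Gam (fib_word_of b xs) = T_word_of b xs" if "length (T_word_of b xs) = n" for b xs
    using that assms length_fib_word_of[of b xs] by (intro Gam_fib_word_of) auto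
  have "Gam ` ?F = {Gam (fib_word_of b xs) |b xs. length (T_word_of b xs) = n}"
    unfolding fib_words_end1_eq[OF assms] by blast
  also have "\<dots> = T_words n"
    unfolding T_words_eq[OF assms] by (intro Collect_cong) (metis Gam)
  finally have image: "Gam ` ?F = T_words n" .
  have inj: "inj_on Gam ?F"
  proof (rule inj_onI)
    fix v w assume "v \<in> ?F" "w \<in> ?F" and eq: "Gam v = Gam w"
    then obtain b xs c ys where
      v: "v = fib_word_of b xs" "length (T_word_of b xs) = n" and
      w: "w = fib_word_of c ys" "length (T_word_of c ys) = n"
      unfolding fib_words_end1_eq[OF assms] by blast
    then have "T_word_of b xs = T_word_of c ys" "T_word_of b xs \<noteq> []"
      using eq Gam assms by auto
    then show "v = w"
      using T_word_of_inject v w by blast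
  qed
  have stat: "exc (Gam w) = des w" if "w \<in> ?F" for w
    using that unfolding fib_words_end1_eq[OF assms]
    by (auto simp: Gam exc_T_word_of des_fib_word_of)
  have "finite ?F"
    by (rule finite_subset[OF _ finite_lists_length_eq[of "{1, 2}" n]])
      (auto simp: fib_words_end1_def fibonacci_word_def)
  moreover have "card {w \<in> ?F. des w = j} = card {w \<in> T_words n. exc w = j}" for j
  proof -
    \<comment> \<open>Since \<open>Gam\<close> takes \<open>des\<close> to \<open>exc\<close> and
      maps onto \<open>T_words n\<close>, it restricts to bijections between level sets.\<close>
    have "{w \<in> T_words n. exc w = j} = Gam ` {w \<in> ?F. des w = j}"
      unfolding image[symmetric] using stat by auto
    moreover have "inj_on Gam {w \<in> ?F. des w = j}"
      using inj by (rule inj_on_subset) auto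
    ultimately show ?thesis
      by (simp add: card_image)
  qed
  moreover from \<open>finite ?F\<close> have "finite (T_words n)"
    unfolding image[symmetric] by (rule finite_imageI)
  ultimately show ?thesis
    by (simp add: image eulerian_pair_def)
qed

end
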